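(* Let $D=(V,E)$ be a finite directed graph with two distinct distinguished vertices $b$ and $r$ such that from every vertex there is a directed path to at least one of $b,r$. Suppose Blue and Red play the Richman game on $D$ with the token initially located at vertex $v$. If Blue's share of the total money supply is less than $R(v)=\lim_{t\to\infty}R(v,t)$, where $R(v,t)$ is the auxiliary function defined in the context, then Red has a winning strategy.
   Context: Richman game on $D$: two players, Blue and Red, each have a nonnegative real amount of money, the total being positive. A token rests on a vertex of $D$. On each turn, both players simultaneously and secretly bid a nonnegative real number no larger than the amount of money they currently have; the bids are then revealed. The higher bidder pays the amount of his or her bid to the opponent and moves the token from its current vertex along an arc of $D$ to a successor vertex of his or her choice. If the bids are equal, a fair coin toss decides who is treated as the higher bidder. The game ends when the token reaches $b$ (Blue wins) or $r$ (Red wins); a token located at $b$ (resp. $r$) at the start means that Blue (resp. Red) has already won. If neither $b$ nor $r$ is ever reached, the game is a draw. Money has no value at the end of the game. A player's share of the total money supply is the player's money divided by the total money of the two players. A winning strategy for a player is a policy for bidding and moving (given the initial data: the token's position, and the amounts of money of both players) that guarantees that player the victory, whatever the opponent does and whatever the coin tosses. Auxiliary function: for $v\in V$ let $S(v)=\{w\in V:(v,w)\in E\}$. Define $R(b,t)=0$ and $R(r,t)=1$ for all $t\in\{0,1,2,\dots\}$; for $v\notin\{b,r\}$ define $R(v,0)=1$ and, for $t>0$, $R(v,t)=\frac12\left(\max_{w\in S(v)}R(w,t-1)+\min_{u\in S(v)}R(u,t-1)\right)$. For each $v$ the sequence $R(v,t)$ is weakly decreasing in $t$ and bounded below by $0$,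 so the limit $R(v)$ exists. *)

theory Defs
  imports Complex_Main "Graph_Theory.Pair_Digraph"
begin

datatype player = Blue | Red

fun opponent :: "player \<Rightarrow> player" where
  "opponent Blue = Red"
| "opponent Red = Blue"

record 'a state =
  pos :: 'a
  money :: "player \<Rightarrow> real"

text \<open>
  One turn of the game, as both players know it once it is completed: both bids, the player treated
  as the higher bidder (decided by the coin if the bids are equal), and the vertex to which that
  player moves the token.
\<close>

record 'a turn =
  bids :: "player \<Rightarrow> real"
  mover :: player
  dest :: 'a

definition share :: "(player \<Rightarrow> real) \<Rightarrow> player \<Rightarrow> real" where
  "share m p = m p / (m Blue + m Red)"

definition succs :: "'a pair_pre_digraph \<Rightarrow> 'a \<Rightarrow> 'a set" where
  "succs D v = {w \<in> pverts D. (v, w) \<in> parcs D}"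

definition legal_bids :: "'a state \<Rightarrow> (player \<Rightarrow> real) \<Rightarrow> bool" where
  "legal_bids s \<beta> \<longleftrightarrow> (\<forall>p. 0 \<le> \<beta> p \<and> \<beta> p \<le> money s p)"

text \<open>For equal bids the mover is unconstrained: this is the outcome of the coin toss.\<close>

definition legal_turn :: "'a pair_pre_digraph \<Rightarrow> 'a state \<Rightarrow> 'a turn \<Rightarrow> bool" where
  "legal_turn D s x \<longleftrightarrow>
     legal_bids s (bids x) \<and>
     bids x (opponent (mover x)) \<le> bids x (mover x) \<and>
     dest x \<in> succs D (pos s)"

definition next_state :: "'a state \<Rightarrow> 'a turn \<Rightarrow> 'a state" where
  "next_state s x =
     (let p = mover x; q = opponent p; a = bids x p in
      \<lparr>pos = dest x, money = (money s)(p := money s p - a, q := money s q + a)\<rparr>)"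

definition state_after :: "'a state \<Rightarrow> 'a turn list \<Rightarrow> 'a state" where
  "state_after s0 h = foldl next_state s0 h"

text \<open>After the turns \<open>h\<close> the game has not ended (nor had it ended at any earlier time).\<close>

definition ongoing :: "'a \<Rightarrow> 'a \<Rightarrow> 'a state \<Rightarrow> 'a turn list \<Rightarrow> bool" where
  "ongoing b r s0 h \<longleftrightarrow> (\<forall>k\<le>length h. pos (state_after s0 (take k h)) \<notin> {b, r})"

definition legal_history :: "'a pair_pre_digraph \<Rightarrow> 'a state \<Rightarrow> 'a turn list \<Rightarrow> bool" where
  "legal_history D s0 h \<longleftrightarrow> (\<forall>k<length h. legal_turn D (state_after s0 (take k h)) (h ! k))"

text \<open>
  A policy depends on all completed turns. The bid is chosen without knowledge of the opponent's
  current bid; the move, made only if the player is the mover, is chosen after both bids have been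
  revealed.
\<close>

record 'a policy =
  policy_bid :: "'a turn list \<Rightarrow> real"
  policy_move :: "'a turn list \<Rightarrow> (player \<Rightarrow> real) \<Rightarrow> 'a"

definition is_policy ::
  "'a pair_pre_digraph \<Rightarrow> 'a \<Rightarrow> 'a \<Rightarrow> 'a state \<Rightarrow> player \<Rightarrow> 'a policy \<Rightarrow> bool" where
  "is_policy D b r s0 p \<sigma> \<longleftrightarrow>
     (\<forall>h. legal_history D s0 h \<and> ongoing b r s0 h \<longrightarrow>
        0 \<le> policy_bid \<sigma> h \<and> policy_bid \<sigma> h \<le> money (state_after s0 h) p \<and>
        (\<forall>\<beta>. legal_bids (state_after s0 h) \<beta> \<longrightarrow>
           policy_move \<sigma> h \<beta> \<in> succs D (pos (state_after s0 h))))"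

definition follows_turn :: "player \<Rightarrow> 'a policy \<Rightarrow> 'a turn list \<Rightarrow> 'a turn \<Rightarrow> bool" where
  "follows_turn p \<sigma> h x \<longleftrightarrow>
     bids x p = policy_bid \<sigma> h \<and> (mover x = p \<longrightarrow> dest x = policy_move \<sigma> h (bids x))"

definition turns_before :: "(nat \<Rightarrow> 'a turn) \<Rightarrow> nat \<Rightarrow> 'a turn list" where
  "turns_before \<tau> n = map \<tau> [0..<n]"

text \<open>
  A play is given by an infinite sequence of turns, of which those after the end of the game, if it
  ends, are meaningless and unconstrained.
\<close>

definition is_play ::
  "'a pair_pre_digraph \<Rightarrow> 'a \<Rightarrow> 'a \<Rightarrow> 'a state \<Rightarrow> (nat \<Rightarrow> 'a turn) \<Rightarrow> bool" where
  "is_play D b r s0 \<tau> \<longleftrightarrow>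
     (\<forall>n. ongoing b r s0 (turns_before \<tau> n) \<longrightarrow>
        legal_turn D (state_after s0 (turns_before \<tau> n)) (\<tau> n))"

definition follows ::
  "'a \<Rightarrow> 'a \<Rightarrow> 'a state \<Rightarrow> player \<Rightarrow> 'a policy \<Rightarrow> (nat \<Rightarrow> 'a turn) \<Rightarrow> bool" where
  "follows b r s0 p \<sigma> \<tau> \<longleftrightarrow>
     (\<forall>n. ongoing b r s0 (turns_before \<tau> n) \<longrightarrow> follows_turn p \<sigma> (turns_before \<tau> n) (\<tau> n))"

fun target :: "'a \<Rightarrow> 'a \<Rightarrow> player \<Rightarrow> 'a" where
  "target b r Blue = b"
| "target b r Red = r"

definition wins_play ::
  "'a \<Rightarrow> 'a \<Rightarrow> 'a state \<Rightarrow> player \<Rightarrow> (nat \<Rightarrow> 'a turn) \<Rightarrow> bool" where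
  "wins_play b r s0 p \<tau> \<longleftrightarrow>
     (\<exists>n. pos (state_after s0 (turns_before \<tau> n)) = target b r p \<and>
          (\<forall>k<n. pos (state_after s0 (turns_before \<tau> k)) \<notin> {b, r}))"

text \<open>
  Quantifying over all plays that follow the policy quantifies over every behaviour of the opponent
  and all coin tosses.
\<close>

definition winning_strategy ::
  "'a pair_pre_digraph \<Rightarrow> 'a \<Rightarrow> 'a \<Rightarrow> 'a state \<Rightarrow> player \<Rightarrow> 'a policy \<Rightarrow> bool" where
  "winning_strategy D b r s0 p \<sigma> \<longleftrightarrow>
     is_policy D b r s0 p \<sigma> \<and>
     (\<forall>\<tau>. is_play D b r s0 \<tau> \<and> follows b r s0 p \<sigma> \<tau> \<longrightarrow> wins_play b r s0 p \<tau>)"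

fun R_aux :: "'a pair_pre_digraph \<Rightarrow> 'a \<Rightarrow> 'a \<Rightarrow> 'a \<Rightarrow> nat \<Rightarrow> real" where
  "R_aux D b r v 0 = (if v = b then 0 else 1)"
| "R_aux D b r v (Suc t) =
     (if v = b then 0 else if v = r then 1
      else (Max ((\<lambda>w. R_aux D b r w t) ` succs D v) +
            Min ((\<lambda>u. R_aux D b r u t) ` succs D v)) / 2)"

definition R_lim :: "'a pair_pre_digraph \<Rightarrow> 'a \<Rightarrow> 'a \<Rightarrow> 'a \<Rightarrow> real" where
  "R_lim D b r v = lim (\<lambda>t. R_aux D b r v t)"

end

theory Submission
  imports Defs
begin

text \<open>
  Start the averaging recursion of \<^const>\<open>R_aux\<close> not from \<open>1\<close> off \<open>b\<close> but from \<open>0\<close> off \<open>r\<close>.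
  The values then increase, and the value at time \<open>t\<close> is a threshold with a meaning for Red: if
  Blue's share is strictly below it, then Red can force the token to \<open>r\<close> within \<open>t\<close> turns
  (\<open>safe_turn\<close>). Red bids half the difference between the largest and the smallest threshold for
  \<open>t - 1\<close> turns among the successors. If Red moves, to a successor of largest threshold, the share
  that Blue gains is no more than the threshold gains; if Blue moves, Blue has paid at least Red's
  bid, and even a successor of smallest threshold is good enough for Red. At time \<open>0\<close> only \<open>r\<close> has a
  positive threshold, so the token has reached \<open>r\<close> by then.

  It remains to see that the thresholds climb all the way up to \<^const>\<open>R_lim\<close>
  (\<open>low_tendsto_R_lim\<close>). Both recursions are monotone and bounded, and by continuity
  their limits are fixed points of the averaging operator. The fixed point is unique
  (\<open>fixed_point_le\<close>): where the difference of two fixed points attains a positive maximum and,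
  among these vertices, the smaller function is least, all successors share these properties. So the token could
  never leave this set, which contains neither \<open>b\<close> nor \<open>r\<close> because all fixed points agree there; but
  from every vertex there is a path to \<open>b\<close> or \<open>r\<close>.
\<close>

section \<open>The averaging operator\<close>

lemma tendsto_Max_image:
  fixes F :: "nat \<Rightarrow> 'b \<Rightarrow> real"
  assumes "finite A" "A \<noteq> {}" "\<And>w. w \<in> A \<Longrightarrow> (\<lambda>t. F t w) \<longlonglongrightarrow> f w"
  shows "(\<lambda>t. Max (F t ` A)) \<longlonglongrightarrow> Max (f ` A)"
  using assms by (induction A rule: finite_ne_induct) (auto intro!: tendsto_max)

lemma tendsto_Min_image:
  fixes F :: "nat \<Rightarrow> 'b \<Rightarrow> real"
  assumes "finite A" "A \<noteq> {}" "\<And>w. w \<in> A \<Longrightarrow> (\<lambda>t. F t w) \<longlonglongrightarrow> f w"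
  shows "(\<lambda>t. Min (F t ` A)) \<longlonglongrightarrow> Min (f ` A)"
  using assms by (induction A rule: finite_ne_induct) (auto intro!: tendsto_min)

locale richman_graph = pair_fin_digraph D for D :: "'a pair_pre_digraph" +
  fixes b r :: 'a
  assumes b_neq_r: "b \<noteq> r"
    and reaches_end: "\<And>u. u \<in> pverts D \<Longrightarrow>
          u \<rightarrow>\<^sup>*\<^bsub>with_proj D\<^esub> b \<or> u \<rightarrow>\<^sup>*\<^bsub>with_proj D\<^esub> r"
begin

definition succ_max :: "('a \<Rightarrow> real) \<Rightarrow> 'a \<Rightarrow> real" where
  "succ_max f v = Max (f ` succs D v)"

definition succ_min :: "('a \<Rightarrow> real) \<Rightarrow> 'a \<Rightarrow> real" where
  "succ_min f v = Min (f ` succs D v)"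

definition average :: "('a \<Rightarrow> real) \<Rightarrow> 'a \<Rightarrow> real" where
  "average f v = (if v = b then 0 else if v = r then 1 else (succ_max f v + succ_min f v) / 2)"

lemma fixed_point_average:
  assumes "average f v = f v" "v \<notin> {b, r}"
  shows "2 * f v = succ_max f v + succ_min f v"
proof -
  have "average f v = (succ_max f v + succ_min f v) / 2"
    using assms(2) by (simp add: average_def)
  then show ?thesis
    unfolding assms(1) by simp
qed

lemma succs_in_verts: "w \<in> succs D v \<Longrightarrow> w \<in> pverts D"
  by (simp add: succs_def)

lemma finite_succs: "finite (succs D v)"
  by (simp add: succs_def pair_finite_verts)

text \<open>This is the form in which the assumption on paths to \<open>b\<close> or \<open>r\<close> is used from here on.\<close>

lemma closed_set_meets_ends:
  assumes "S \<subseteq> pverts D" "S \<noteq> {}" and closed: "\<And>v w. v \<in> S \<Longrightarrow> w \<in> succs D v \<Longrightarrow> w \<in> S"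
  shows "b \<in> S \<or> r \<in> S"
proof -
  have stays: "z \<in> S" if "u \<rightarrow>\<^sup>*\<^bsub>with_proj D\<^esub> z" "u \<in> S" for u z
    using that
  proof (induction rule: reachable_induct)
    case (step y z)
    have "z \<in> succs D y"
      using step.hyps by (auto simp: succs_def dest: in_arcsD2)
    then show ?case
      using step closed by blast
  qed
  obtain u where "u \<in> S"
    using assms(2) by blast
  then show ?thesis
    using assms(1) reaches_end[of u] stays by blast
qed

lemma succs_nonempty: "v \<in> pverts D \<Longrightarrow> v \<notin> {b, r} \<Longrightarrow> succs D v \<noteq> {}"
  using closed_set_meets_ends[of "{v}"] by auto

lemma succ_max_ge: "w \<in> succs D v \<Longrightarrow> f w \<le> succ_max f v"
  by (simp add: succ_max_def finite_succs)

lemma succ_min_le: "w \<in> succs D v \<Longrightarrow> succ_min f v \<le> f w"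
  by (simp add: succ_min_def finite_succs)

lemma succ_max_attained:
  assumes "v \<in> pverts D" "v \<notin> {b, r}"
  obtains w where "w \<in> succs D v" "f w = succ_max f v"
proof -
  have "succ_max f v \<in> f ` succs D v"
    unfolding succ_max_def using finite_succs succs_nonempty[OF assms] by (intro Max_in) auto
  then show thesis
    using that by (metis imageE)
qed

lemma succ_min_attained:
  assumes "v \<in> pverts D" "v \<notin> {b, r}"
  obtains w where "w \<in> succs D v" "f w = succ_min f v"
proof -
  have "succ_min f v \<in> f ` succs D v"
    unfolding succ_min_def using finite_succs succs_nonempty[OF assms] by (intro Min_in) auto
  then show thesis
    using that by (metis imageE)
qed

lemma average_mono:
  assumes le: "\<And>w. w \<in> pverts D \<Longrightarrow> f w \<le> g w" and v: "v \<in> pverts D"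
  shows "average f v \<le> average g v"
proof (cases "v \<in> {b, r}")
  case False
  obtain w where w: "w \<in> succs D v" "f w = succ_max f v"
    using succ_max_attained[OF v False] .
  obtain u where u: "u \<in> succs D v" "g u = succ_min g v"
    using succ_min_attained[OF v False] .
  have "succ_max f v \<le> succ_max g v"
    using w le[of w] succ_max_ge[of w v g] succs_in_verts by fastforce
  moreover have "succ_min f v \<le> succ_min g v"
    using u le[of u] succ_min_le[of u v f] succs_in_verts by fastforce
  ultimately show ?thesis
    using False by (simp add: average_def)
qed (auto simp: average_def)

lemma average_tendsto:
  assumes "\<And>w. w \<in> pverts D \<Longrightarrow> (\<lambda>t. F t w) \<longlonglongrightarrow> f w" and v: "v \<in> pverts D"
  shows "(\<lambda>t. average (F t) v) \<longlonglongrightarrow> average f v"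
proof (cases "v \<in> {b, r}")
  case False
  have "(\<lambda>t. (succ_max (F t) v + succ_min (F t) v) / 2) \<longlonglongrightarrow> (succ_max f v + succ_min f v) / 2"
    unfolding succ_max_def succ_min_def
    using assms(1) succs_nonempty[OF v False] finite_succs succs_in_verts
    by (intro tendsto_intros tendsto_Max_image tendsto_Min_image) auto
  then show ?thesis
    using False by (simp add: average_def)
qed (auto simp: average_def)

lemma limit_is_fixed_point:
  assumes "\<And>w. w \<in> pverts D \<Longrightarrow> (\<lambda>t. F t w) \<longlonglongrightarrow> f w"
    and "\<And>t w. F (Suc t) w = average (F t) w" and "v \<in> pverts D"
  shows "average f v = f v"
proof (rule LIMSEQ_unique)
  show "(\<lambda>t. F (Suc t) v) \<longlonglongrightarrow> f v"
    using assms(1)[OF assms(3)] by (rule LIMSEQ_Suc)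
  show "(\<lambda>t. F (Suc t) v) \<longlonglongrightarrow> average f v"
    using average_tendsto[OF assms(1,3)] by (simp add: assms(2))
qed

section \<open>Uniqueness of the fixed point\<close>

text \<open>
  The averages of two functions that differ by at most \<open>M\<close> can differ by \<open>M\<close> only if the
  differences at the maxima and at the minima are both \<open>M\<close>. A maximum of the larger function is
  then a vertex of difference \<open>M\<close>, and so is a minimum of the smaller one.
\<close>

lemma extremal_difference_at_succs:
  assumes f: "average f v = f v" and g: "average g v = g v"
    and v: "v \<in> pverts D" "v \<notin> {b, r}"
    and M: "\<And>w. w \<in> pverts D \<Longrightarrow> f w - g w \<le> M" and eq: "f v - g v = M"
  obtains w u where "w \<in> succs D v" "f w = succ_max f v" "g w = f w - M"
    and "u \<in> succs D v" "g u = succ_min g v" "g u = f u - M"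
proof -
  obtain w where w: "w \<in> succs D v" "f w = succ_max f v"
    using succ_max_attained[OF v] .
  obtain u where u: "u \<in> succs D v" "g u = succ_min g v"
    using succ_min_attained[OF v] .
  have *: "f w - g w \<le> M" "f u - g u \<le> M"
    using M w(1) u(1) succs_in_verts by auto
  have "g w \<le> succ_max g v" "succ_min f v \<le> f u"
    using w(1) u(1) succ_max_ge succ_min_le by auto
  moreover have "succ_max f v + succ_min f v - (succ_max g v + succ_min g v) = 2 * M"
    using fixed_point_average[OF f v(2)] fixed_point_average[OF g v(2)] eq by linarith
  ultimately have "g w = f w - M" "g u = f u - M"
    using * w(2) u(2) by linarith+
  then show thesis
    using w u that by blast
qed

lemma fixed_point_le:
  assumes f: "\<And>v. v \<in> pverts D \<Longrightarrow> average f v = f v"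
    and g: "\<And>v. v \<in> pverts D \<Longrightarrow> average g v = g v"
    and x: "x \<in> pverts D"
  shows "f x \<le> g x"
proof (rule ccontr)
  assume "\<not> f x \<le> g x"
  define M where "M = Max ((\<lambda>v. f v - g v) ` pverts D)"
  have M: "f v - g v \<le> M" if "v \<in> pverts D" for v
    unfolding M_def using that pair_finite_verts by simp
  have "M > 0"
    using M[OF x] \<open>\<not> f x \<le> g x\<close> by linarith
  define A where "A = {v \<in> pverts D. f v - g v = M}"
  have "M \<in> (\<lambda>v. f v - g v) ` pverts D"
    unfolding M_def using pair_finite_verts x by (intro Max_in) auto
  then obtain y where "y \<in> pverts D" "M = f y - g y"
    by (rule imageE)
  then have "A \<noteq> {}"
    unfolding A_def by force
  have "finite A"
    using pair_finite_verts by (simp add: A_def)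
  define c where "c = Min (g ` A)"
  define S where "S = {v \<in> A. g v = c}"
  have c: "c \<le> g v" if "v \<in> A" for v
    unfolding c_def using that \<open>finite A\<close> by simp
  have "c \<in> g ` A"
    unfolding c_def using \<open>finite A\<close> \<open>A \<noteq> {}\<close> by (intro Min_in) auto
  then have "S \<noteq> {}"
    by (auto simp: S_def)
  have end_notin: "v \<notin> {b, r}" if "v \<in> S" for v
  proof
    assume "v \<in> {b, r}"
    then have "average f v = average g v"
      by (auto simp: average_def)
    moreover have "v \<in> pverts D" "f v - g v = M"
      using that by (auto simp: S_def A_def)
    ultimately show False
      using f[of v] g[of v] \<open>M > 0\<close> by linarith
  qed
  have closed: "y \<in> S" if "v \<in> S" "y \<in> succs D v" for v y
  proof -
    have v: "v \<in> pverts D" "f v - g v = M" "g v = c" "v \<notin> {b, r}"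
      using that(1) end_notin by (auto simp: S_def A_def)
    obtain w u where w: "w \<in> succs D v" "f w = succ_max f v" "g w = f w - M"
      and u: "u \<in> succs D v" "g u = succ_min g v" "g u = f u - M"
      using extremal_difference_at_succs[OF f[OF v(1)] g[OF v(1)] v(1,4) M v(2)] by blast
    have avg: "2 * f v = succ_max f v + succ_min f v" "2 * g v = succ_max g v + succ_min g v"
      using fixed_point_average[OF f[OF v(1)] v(4)] fixed_point_average[OF g[OF v(1)] v(4)]
      by blast+
    \<comment> \<open>Leastness of \<open>c\<close> makes the minimum of \<open>g\<close> over the successors equal to the average of
      maximum and minimum, so \<open>g\<close> is constant there; through \<open>w\<close> the same follows for \<open>f\<close>.\<close>
    have "u \<in> A"
      using u(1,3) succs_in_verts[OF u(1)] by (simp add: A_def)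
    then have "c \<le> g u"
      by (rule c)
    then have "succ_min g v = c" "succ_max g v = c"
      using avg(2) v(3) u(1,2) succ_max_ge[of u v g] by linarith+
    then have g_const: "g z = c" if "z \<in> succs D v" for z
      using succ_max_ge[OF that, of g] succ_min_le[OF that, of g] by linarith
    then have "succ_max f v = f v"
      using g_const[OF w(1)] w(2,3) v(2,3) by linarith
    then have f_const: "f z = f v" if "z \<in> succs D v" for z
      using succ_max_ge[OF that, of f] succ_min_le[OF that, of f] avg(1) by linarith
    show ?thesis
      using g_const[OF that(2)] f_const[OF that(2)] v(2,3) succs_in_verts[OF that(2)]
      by (simp add: S_def A_def)
  qed
  have "S \<subseteq> pverts D"
    by (auto simp: S_def A_def)
  from closed_set_meets_ends[OF this \<open>S \<noteq> {}\<close>] closed have "b \<in> S \<or> r \<in> S" .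
  then show False
    using end_notin by blast
qed

section \<open>Approximation from below\<close>

text \<open>
  The threshold for Red: if the token is at \<open>v\<close> and Blue's share is below \<open>low t v\<close>, then Red can win
  within \<open>t\<close> turns.
\<close>

fun low :: "nat \<Rightarrow> 'a \<Rightarrow> real" where
  "low 0 = (\<lambda>v. if v = r then 1 else 0)"
| "low (Suc t) = average (low t)"

abbreviation high :: "nat \<Rightarrow> 'a \<Rightarrow> real" where
  "high t \<equiv> (\<lambda>v. R_aux D b r v t)"

lemma high_Suc: "high (Suc t) v = average (high t) v"
  by (simp add: average_def succ_max_def succ_min_def)

declare R_aux.simps(2) [simp del]

lemma low_at_b: "low t b = 0" and low_at_r: "low t r = 1"
  using b_neq_r by (cases t; simp add: average_def)+

text \<open>
  Since both recursions apply the same monotone operator, the order of their initial values persists;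
  each then supplies the bound that the other needs to converge.
\<close>

lemma low_le_high: "v \<in> pverts D \<Longrightarrow> low t v \<le> high t v"
proof (induction t arbitrary: v)
  case (Suc t)
  show ?case
    unfolding low.simps high_Suc by (rule average_mono) (use Suc in auto)
qed (use b_neq_r in auto)

lemma low_increasing: "v \<in> pverts D \<Longrightarrow> low t v \<le> low (Suc t) v"
proof (induction t arbitrary: v)
  case 0
  show ?case
  proof (cases "v \<in> {b, r}")
    case False
    obtain w where "w \<in> succs D v" "low 0 w = succ_max (low 0) v"
      using succ_max_attained[OF 0 False] .
    moreover obtain u where "u \<in> succs D v" "low 0 u = succ_min (low 0) v"
      using succ_min_attained[OF 0 False] .
    moreover have "low 0 z \<ge> 0" for z
      by simp
    ultimately have "succ_max (low 0) v \<ge> 0" "succ_min (low 0) v \<ge> 0"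
      by metis+
    then show ?thesis
      using False by (simp add: average_def)
  qed (use low_at_b low_at_r in \<open>auto simp del: low.simps\<close>)
next
  case (Suc t)
  show ?case
    unfolding low.simps(2)[of "Suc t"] low.simps(2)[of t]
    by (rule average_mono) (use Suc in auto)
qed

lemma high_decreasing: "v \<in> pverts D \<Longrightarrow> high (Suc t) v \<le> high t v"
proof (induction t arbitrary: v)
  case 0
  show ?case
  proof (cases "v \<in> {b, r}")
    case False
    obtain w where "w \<in> succs D v" "high 0 w = succ_max (high 0) v"
      using succ_max_attained[OF 0 False] .
    moreover obtain u where "u \<in> succs D v" "high 0 u = succ_min (high 0) v"
      using succ_min_attained[OF 0 False] .
    moreover have "high 0 z \<le> 1" for z
      by simp
    ultimately have "succ_max (high 0) v \<le> 1" "succ_min (high 0) v \<le> 1"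
      by metis+
    then have "average (high 0) v \<le> 1"
      using False by (simp add: average_def)
    then show ?thesis
      using False by (simp add: high_Suc)
  qed (use b_neq_r in \<open>auto simp: high_Suc average_def\<close>)
next
  case (Suc t)
  show ?case
    unfolding high_Suc[of v "Suc t"] high_Suc[of v t] by (rule average_mono) (use Suc in auto)
qed

lemma low_nonneg: "v \<in> pverts D \<Longrightarrow> 0 \<le> low t v"
proof (induction t)
  case (Suc t)
  then show ?case
    using low_increasing[of v t] by linarith
qed simp

lemma high_le_1: "v \<in> pverts D \<Longrightarrow> high t v \<le> 1"
proof (induction t)
  case (Suc t)
  then show ?case
    using high_decreasing[of v t] by linarith
qed simp

lemma high_tendsto_R_lim:
  assumes "v \<in> pverts D"
  shows "(\<lambda>t. high t v) \<longlonglongrightarrow> R_lim D b r v"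
proof -
  have "decseq (\<lambda>t. high t v)"
    using high_decreasing[OF assms] by (rule decseq_SucI)
  moreover have "0 \<le> high t v" for t
    using low_nonneg[OF assms] low_le_high[OF assms] by (rule order_trans)
  ultimately obtain L where "(\<lambda>t. high t v) \<longlonglongrightarrow> L"
    using decseq_convergent[of "\<lambda>t. high t v" 0] by blast
  then show ?thesis
    by (simp add: R_lim_def limI)
qed

lemma low_tendsto_R_lim:
  assumes "v \<in> pverts D"
  shows "(\<lambda>t. low t v) \<longlonglongrightarrow> R_lim D b r v"
proof -
  define f where "f v = lim (\<lambda>t. low t v)" for v
  have f: "(\<lambda>t. low t w) \<longlonglongrightarrow> f w" if "w \<in> pverts D" for w
  proof -
    have "incseq (\<lambda>t. low t w)"
      using low_increasing[OF that] by (rule incseq_SucI)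
    moreover have "low t w \<le> 1" for t
      using low_le_high[OF that] high_le_1[OF that] by (rule order_trans)
    ultimately obtain L where "(\<lambda>t. low t w) \<longlonglongrightarrow> L"
      using incseq_convergent[of "\<lambda>t. low t w" 1] by blast
    then show ?thesis
      by (simp add: f_def limI)
  qed
  have "average f w = f w" if "w \<in> pverts D" for w
    using limit_is_fixed_point[of low f] f that by simp
  moreover have "average (R_lim D b r) w = R_lim D b r w" if "w \<in> pverts D" for w
    using limit_is_fixed_point[of high, OF high_tendsto_R_lim high_Suc that] .
  ultimately have "f v = R_lim D b r v"
    using fixed_point_le[of f "R_lim D b r" v] fixed_point_le[of "R_lim D b r" f v] assms
    by (metis antisym)
  then show ?thesis
    using f[OF assms] by simp
qed

section \<open>The strategy\<close>

definition valid_state :: "'a state \<Rightarrow> bool" where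
  "valid_state s \<longleftrightarrow> pos s \<in> pverts D \<and> (\<forall>p. 0 \<le> money s p) \<and> 0 < money s Blue + money s Red"

definition safe :: "nat \<Rightarrow> 'a state \<Rightarrow> bool" where
  "safe t s \<longleftrightarrow> valid_state s \<and> share (money s) Blue < low t (pos s)"

text \<open>
  The bid is the one suggested by the thresholds for the \<open>t\<close> turns that remain after the current
  one. In safe states Red can afford it; the minimum is there because a policy must also make legal
  bids after turns that it would not have led to.
\<close>

definition red_bid :: "nat \<Rightarrow> 'a state \<Rightarrow> real" where
  "red_bid t s = min (money s Red)
     ((succ_max (low t) (pos s) - succ_min (low t) (pos s)) / 2 * (money s Blue + money s Red))"

definition red_move :: "nat \<Rightarrow> 'a \<Rightarrow> 'a" where
  "red_move t v = (SOME w. w \<in> succs D v \<and> low t w = succ_max (low t) v)"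

lemma red_move:
  assumes "v \<in> pverts D" "v \<notin> {b, r}"
  shows "red_move t v \<in> succs D v" "low t (red_move t v) = succ_max (low t) v"
proof -
  have "\<exists>w. w \<in> succs D v \<and> low t w = succ_max (low t) v"
    using succ_max_attained[OF assms] by metis
  from someI_ex[OF this] show "red_move t v \<in> succs D v"
    "low t (red_move t v) = succ_max (low t) v"
    unfolding red_move_def by auto
qed

lemma red_bid_legal:
  assumes "valid_state s" "pos s \<notin> {b, r}"
  shows "0 \<le> red_bid t s" "red_bid t s \<le> money s Red"
proof -
  obtain w where "w \<in> succs D (pos s)"
    using succs_nonempty assms unfolding valid_state_def by blast
  then have "succ_min (low t) (pos s) \<le> succ_max (low t) (pos s)"
    using succ_max_ge succ_min_le order_trans by blast
  then show "0 \<le> red_bid t s"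
    using assms(1) by (simp add: red_bid_def valid_state_def)
qed (simp add: red_bid_def)

lemma all_player: "(\<forall>p. P p) \<longleftrightarrow> P Blue \<and> P Red"
  by (metis player.exhaust)

lemma valid_state_next:
  assumes "valid_state s" "legal_turn D s x"
  shows "valid_state (next_state s x)"
    and "money (next_state s x) Blue + money (next_state s x) Red = money s Blue + money s Red"
  using assms succs_in_verts
  by (cases "mover x"; force simp: valid_state_def legal_turn_def legal_bids_def next_state_def
      all_player Let_def)+

text \<open>
  The threshold at \<open>pos s\<close> lies in the middle between the largest and the smallest threshold of the
  successors, at distance \<open>d\<close> from both, and Red bids the fraction \<open>d\<close> of the total. If Red moves,
  Blue's share and the threshold both rise by \<open>d\<close>; if Blue moves, the share falls by at least \<open>d\<close> and
  the threshold by at most \<open>d\<close>.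
\<close>

lemma safe_turn:
  assumes safe: "safe (Suc t) s" and ongoing: "pos s \<notin> {b, r}" and legal: "legal_turn D s x"
    and bid: "bids x Red = red_bid t s"
    and move: "mover x = Red \<Longrightarrow> dest x = red_move t (pos s)"
  shows "safe t (next_state s x)"
proof -
  define T where "T = money s Blue + money s Red"
  define hi where "hi = succ_max (low t) (pos s)"
  define lo where "lo = succ_min (low t) (pos s)"
  have valid: "valid_state s" and "pos s \<in> pverts D" and "T > 0"
    using safe by (auto simp: safe_def valid_state_def T_def)
  have "money s Blue / T < (hi + lo) / 2"
    using safe ongoing by (auto simp: safe_def share_def T_def hi_def lo_def average_def)
  then have blue: "money s Blue < (hi + lo) / 2 * T"
    using \<open>T > 0\<close> by (simp add: pos_divide_less_eq)
  \<comment> \<open>Red can afford the bid because no threshold exceeds \<open>1\<close>.\<close>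
  have "hi \<le> 1"
    using red_move[OF \<open>pos s \<in> pverts D\<close> ongoing, of t] low_le_high high_le_1 succs_in_verts
    unfolding hi_def by (metis order_trans)
  then have "hi * T \<le> T"
    using \<open>T > 0\<close> by simp
  then have "(hi - lo) / 2 * T \<le> money s Red"
    using blue by (simp add: T_def field_simps)
  then have bid': "bids x Red = (hi - lo) / 2 * T"
    unfolding bid red_bid_def hi_def lo_def T_def by (rule min_absorb2)
  have next_T: "money (next_state s x) Blue + money (next_state s x) Red = T"
    using valid_state_next(2)[OF valid legal] by (simp add: T_def)
  have "money (next_state s x) Blue < low t (dest x) * T"
  proof (cases "mover x")
    case Red
    then have "low t (dest x) = hi"
      using move red_move[OF \<open>pos s \<in> pverts D\<close> ongoing, of t] by (simp add: hi_def)
    then show ?thesis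
      using Red blue bid' by (simp add: next_state_def Let_def field_simps)
  next
    case Blue
    then have "lo \<le> low t (dest x)" "bids x Red \<le> bids x Blue"
      using legal succ_min_le by (auto simp: legal_turn_def lo_def)
    moreover from this(1) have "lo * T \<le> low t (dest x) * T"
      using \<open>T > 0\<close> by simp
    ultimately show ?thesis
      using Blue blue bid' by (simp add: next_state_def Let_def field_simps)
  qed
  then show ?thesis
    using valid_state_next(1)[OF valid legal] \<open>T > 0\<close> next_T
    by (simp add: safe_def share_def pos_divide_less_eq) (simp add: next_state_def Let_def)
qed

section \<open>From turns to plays\<close>

lemma state_after_snoc: "state_after s (h @ [x]) = next_state (state_after s h) x"
  by (simp add: state_after_def)

lemma legal_history_snoc:
  "legal_history D s (h @ [x]) \<longleftrightarrow> legal_history D s h \<and> legal_turn D (state_after s h) x"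
  by (auto simp: legal_history_def nth_append less_Suc_eq)

lemma valid_state_after:
  "valid_state s \<Longrightarrow> legal_history D s h \<Longrightarrow> valid_state (state_after s h)"
proof (induction h rule: rev_induct)
  case Nil
  then show ?case
    by (simp add: state_after_def)
next
  case (snoc x h)
  then show ?case
    by (simp add: legal_history_snoc state_after_snoc valid_state_next)
qed

lemma turns_before_0: "turns_before \<tau> 0 = []"
  and turns_before_Suc: "turns_before \<tau> (Suc n) = turns_before \<tau> n @ [\<tau> n]"
  and length_turns_before: "length (turns_before \<tau> n) = n"
  by (simp_all add: turns_before_def)

lemma ongoing_turns_before:
  "ongoing b r s (turns_before \<tau> n) \<longleftrightarrow> (\<forall>k\<le>n. pos (state_after s (turns_before \<tau> k)) \<notin> {b, r})"
  by (simp add: ongoing_def turns_before_def take_map)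

definition red_policy :: "nat \<Rightarrow> 'a state \<Rightarrow> 'a policy" where
  "red_policy N s =
     \<lparr>policy_bid = \<lambda>h. red_bid (N - Suc (length h)) (state_after s h),
      policy_move = \<lambda>h \<beta>. red_move (N - Suc (length h)) (pos (state_after s h))\<rparr>"

lemma is_policy_red_policy:
  assumes "valid_state s"
  shows "is_policy D b r s Red (red_policy N s)"
proof -
  have "valid_state (state_after s h)" "pos (state_after s h) \<notin> {b, r}"
    if "legal_history D s h" "ongoing b r s h" for h
    using valid_state_after[OF assms that(1)] that(2) by (auto simp: ongoing_def)
  then show ?thesis
    unfolding is_policy_def red_policy_def
    using red_bid_legal red_move(1) by (auto simp: valid_state_def)
qed

lemma red_policy_wins_play:
  assumes safe: "safe N s" and play: "is_play D b r s \<tau>"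
    and follows: "follows b r s Red (red_policy N s) \<tau>"
  shows "wins_play b r s Red \<tau>"
proof (rule ccontr)
  assume no_win: "\<not> wins_play b r s Red \<tau>"
  define st where "st n = state_after s (turns_before \<tau> n)" for n
  \<comment> \<open>The threshold at \<open>b\<close> is \<open>0\<close> at all times, so a safe token is never there.\<close>
  have not_b: "pos (st n) \<noteq> b" if "safe t (st n)" for t n
  proof
    assume "pos (st n) = b"
    then have "share (money (st n)) Blue < 0"
      using that low_at_b by (simp add: safe_def)
    then show False
      using that by (simp add: safe_def valid_state_def share_def divide_less_0_iff)
        (smt (verit))
  qed
  have inv: "safe (N - n) (st n) \<and> (\<forall>k\<le>n. pos (st k) \<notin> {b, r})" if "n \<le> N" for n
    using that
  proof (induction n)
    case 0
    have "safe N (st 0)"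
      using safe by (simp add: st_def turns_before_0 state_after_def)
    moreover have "pos (st 0) \<noteq> r"
      using no_win by (auto simp: wins_play_def st_def)
    ultimately show ?case
      using not_b[of N 0] by simp
  next
    case (Suc n)
    then have IH: "safe (N - n) (st n)" "\<forall>k\<le>n. pos (st k) \<notin> {b, r}"
      by auto
    then have og: "ongoing b r s (turns_before \<tau> n)"
      by (simp add: ongoing_turns_before st_def)
    have t: "N - n = Suc (N - Suc n)"
      using Suc.prems by simp
    have "safe (N - Suc n) (next_state (st n) (\<tau> n))"
    proof (rule safe_turn)
      show "safe (Suc (N - Suc n)) (st n)" "pos (st n) \<notin> {b, r}"
        using IH t by auto
      show "legal_turn D (st n) (\<tau> n)"
        using play og by (simp add: is_play_def st_def)
      show "bids (\<tau> n) Red = red_bid (N - Suc n) (st n)"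
        "mover (\<tau> n) = Red \<Longrightarrow> dest (\<tau> n) = red_move (N - Suc n) (pos (st n))"
        using follows og
        by (simp_all add: follows_def follows_turn_def red_policy_def st_def length_turns_before)
    qed
    then have safe': "safe (N - Suc n) (st (Suc n))"
      by (simp add: st_def turns_before_Suc state_after_snoc)
    moreover have "pos (st (Suc n)) \<noteq> r"
      using no_win IH(2) by (force simp: wins_play_def st_def less_Suc_eq_le)
    ultimately show ?case
      using IH(2) not_b[OF safe'] by (auto simp: le_Suc_eq)
  qed
  \<comment> \<open>With no turns left the threshold is \<open>0\<close> off \<open>r\<close>, and a share is never negative.\<close>
  have "safe 0 (st N)" "pos (st N) \<noteq> r"
    using inv[of N] by auto
  then have "share (money (st N)) Blue < 0" "valid_state (st N)"
    by (simp_all add: safe_def)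
  then show False
    by (simp add: valid_state_def share_def divide_less_0_iff) (smt (verit))
qed

end

theorem corollary5:
  fixes D :: "'a pair_pre_digraph" and b r v :: 'a and m :: "player \<Rightarrow> real"
  assumes "pair_fin_digraph D"
    and "b \<in> pverts D" and "r \<in> pverts D" and "b \<noteq> r"
    and "\<And>u. u \<in> pverts D \<Longrightarrow> u \<rightarrow>\<^sup>*\<^bsub>with_proj D\<^esub> b \<or> u \<rightarrow>\<^sup>*\<^bsub>with_proj D\<^esub> r"
    and "v \<in> pverts D"
    and "0 \<le> m Blue" and "0 \<le> m Red" and "0 < m Blue + m Red"
    and "share m Blue < R_lim D b r v"
  shows "\<exists>\<sigma>. winning_strategy D b r \<lparr>pos = v, money = m\<rparr> Red \<sigma>"
proof -
  interpret pair_fin_digraph D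
    by (rule assms(1))
  interpret richman_graph D b r
    by unfold_locales (use assms(4,5) in auto)
  define s where "s = \<lparr>pos = v, money = m\<rparr>"
  have "\<forall>\<^sub>F t in sequentially. share m Blue < low t v"
    using low_tendsto_R_lim[OF assms(6)] assms(10) by (rule order_tendstoD)
  then obtain N where "share m Blue < low N v"
    by (auto dest: eventually_happens)
  then have "safe N s"
    using assms(6-9) by (simp add: safe_def valid_state_def s_def all_player)
  moreover from this have "is_policy D b r s Red (red_policy N s)"
    by (intro is_policy_red_policy) (simp add: safe_def)
  ultimately have "winning_strategy D b r s Red (red_policy N s)"
    using red_policy_wins_play by (simp add: winning_strategy_def)
  then show ?thesis
    unfolding s_def by blast
qed

end
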